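(* Let $p\ge 0$ be an integer and $\lambda=(\lambda_0,\dots,\lambda_p)\in\mathbb{R}^{p+1}$. The Gaussian product $\mathscr{P}_{\lambda_0}\otimes\cdots\otimes\mathscr{P}_{\lambda_p}$ of the power means $\mathscr{P}_{\lambda_0},\dots,\mathscr{P}_{\lambda_p}$ is a weak-Hardy mean if and only if it is a Hardy mean.
   Context: $\mathbb{R}_+=(0,+\infty)$. For $\alpha\in\mathbb{R}$ the power mean $\mathscr{P}_\alpha$ on $\mathbb{R}_+$ is $\mathscr{P}_\alpha(a_1,\dots,a_n)=\big(\tfrac1n\sum_{i=1}^n a_i^\alpha\big)^{1/\alpha}$ for $\alpha\neq0$ and $\mathscr{P}_0(a_1,\dots,a_n)=(a_1\cdots a_n)^{1/n}$. The Gaussian product of $\mathscr{P}_{\lambda_0},\dots,\mathscr{P}_{\lambda_p}$ is the mean on $\mathbb{R}_+$ defined as follows: for $n\in\mathbb{N}$ and $v\in\mathbb{R}_+^n$ set $v^{(0)}=v$ and $v^{(i+1)}=\big(\mathscr{P}_{\lambda_0}(v^{(i)}),\dots,\mathscr{P}_{\lambda_p}(v^{(i)})\big)\in\mathbb{R}_+^{p+1}$ for $i\ge0$; then all coordinates of $v^{(i)}$ converge, as $i\to\infty$, to a common limit, and this limit is the value $(\mathscr{P}_{\lambda_0}\otimes\cdots\otimes\mathscr{P}_{\lambda_p})(v)$. For an interval $I\subset[0,+\infty)$, $\ell_1(I)$ denotes the set of summable sequences with all terms in $I$. A mean $\mathscr{M}\colon\bigcup_{n=1}^\infty I^n\to I$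 on $I$ is a Hardy mean if there is a finite constant $C$ such that $\sum_{n=1}^\infty \mathscr{M}(a_1,\dots,a_n)\le C\sum_{n=1}^\infty a_n$ for all $a\in\ell_1(I)$; it is a weak-Hardy mean if $\sum_{n=1}^\infty \mathscr{M}(a_1,\dots,a_n)<+\infty$ for all $a\in\ell_1(I)$. *)

theory Defs
  imports "HOL-Analysis.Analysis"
begin

text \<open>
  Vectors in \<open>I^n\<close> with varying \<open>n \<ge> 1\<close> are nonempty lists, so a mean on \<open>I\<close> is a function
  of type \<open>real list \<Rightarrow> real\<close>; its values at lists that are empty or not contained in \<open>I\<close>
  are irrelevant.
\<close>

definition power_mean :: "real \<Rightarrow> real list \<Rightarrow> real" where
  "power_mean \<alpha> xs =
     (if \<alpha> = 0 then root (length xs) (prod_list xs)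
      else ((\<Sum>x\<leftarrow>xs. x powr \<alpha>) / real (length xs)) powr (1 / \<alpha>))"

definition gauss_iter :: "real list \<Rightarrow> real list \<Rightarrow> nat \<Rightarrow> real list" where
  "gauss_iter lam v i = ((\<lambda>w. map (\<lambda>\<alpha>. power_mean \<alpha> w) lam) ^^ i) v"

text \<open>
  The initial vector may have any length, but all later iterates have the length of \<open>lam\<close>;
  the index is shifted by one so that every coordinate below \<open>length lam\<close> exists.
\<close>

definition gauss_product :: "real list \<Rightarrow> real list \<Rightarrow> real" where
  "gauss_product lam v =
     (THE L. \<forall>k<length lam. (\<lambda>i. gauss_iter lam v (Suc i) ! k) \<longlonglongrightarrow> L)"

definition l1_seqs :: "real set \<Rightarrow> (nat \<Rightarrow> real) set" where
  "l1_seqs I = {a. (\<forall>n. a n \<in> I) \<and> summable a}"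

text \<open>
  Sequences are indexed from 0, so \<open>map a [0..<Suc n]\<close> lists the first \<open>n + 1\<close> terms. For
  \<open>I\<close> contained in the nonnegative reals, summability of the nonnegative values says that their
  sum is finite; in the Hardy inequality it must be required, since \<open>suminf\<close> of a divergent
  series is a junk value.
\<close>

definition hardy_mean :: "real set \<Rightarrow> (real list \<Rightarrow> real) \<Rightarrow> bool" where
  "hardy_mean I M \<longleftrightarrow>
     (\<exists>C. \<forall>a\<in>l1_seqs I.
        summable (\<lambda>n. M (map a [0..<Suc n])) \<and>
        (\<Sum>n. M (map a [0..<Suc n])) \<le> C * (\<Sum>n. a n))"

definition weak_hardy_mean :: "real set \<Rightarrow> (real list \<Rightarrow> real) \<Rightarrow> bool" where
  "weak_hardy_mean I M \<longleftrightarrow>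
     (\<forall>a\<in>l1_seqs I. summable (\<lambda>n. M (map a [0..<Suc n])))"

end

theory Submission
  imports Defs
begin

text \<open>
  If all exponents are less than one, the Gaussian product is at most the sum of the power means
  involved, each of which is Hardy. If some exponent is at least one, that mean is at least
  \<open>a\<^sub>1 / n\<close>, and since the spread of a vector is contracted at a bounded rate while its smallest
  coordinate grows geometrically, the Gaussian product of a decreasing sequence is at least
  \<open>c * (a\<^sub>1 / n) powr \<theta> * a\<^sub>n powr (1 - \<theta>)\<close> for some \<open>0 < \<theta> < 1\<close>. For the summable sequence
  \<open>a\<^sub>n = 1 / (n * ln n powr s)\<close> with \<open>s = 1 / (1 - \<theta>) > 1\<close> this bound is of order \<open>1 / (n * ln n)\<close>,
  so the weak Hardy property fails.
\<close>

subsection \<open>Power means\<close>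

text \<open>One distinguished entry keeps its exact value while all others are replaced by a common
  lower bound. Applied to negated powers, it also serves negative exponents.\<close>

lemma sum_list_map_ge:
  fixes f :: "'a \<Rightarrow> real"
  assumes "\<And>x. x \<in> set xs \<Longrightarrow> c \<le> f x" and "y \<in> set xs"
  shows "f y + (real (length xs) - 1) * c \<le> (\<Sum>x\<leftarrow>xs. f x)"
proof -
  obtain us vs where xs: "xs = us @ y # vs"
    using assms(2) by (meson split_list)
  have "(\<Sum>x\<leftarrow>us. c) \<le> (\<Sum>x\<leftarrow>us. f x)" "(\<Sum>x\<leftarrow>vs. c) \<le> (\<Sum>x\<leftarrow>vs. f x)"
    using assms(1) xs by (intro sum_list_mono; simp)+
  then show ?thesis
    by (simp add: xs sum_list_triv algebra_simps)
qed

lemma sum_list_map_le: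
  fixes f :: "'a \<Rightarrow> real"
  assumes "\<And>x. x \<in> set xs \<Longrightarrow> f x \<le> c"
  shows "(\<Sum>x\<leftarrow>xs. f x) \<le> real (length xs) * c"
  using sum_list_mono[of xs f "\<lambda>_. c"] assms by (simp add: sum_list_triv)

lemma sum_list_map_uminus:
  fixes f :: "'a \<Rightarrow> real"
  shows "(\<Sum>x\<leftarrow>xs. - f x) = - (\<Sum>x\<leftarrow>xs. f x)"
  by (induction xs) auto

lemma ln_prod_list:
  assumes "set xs \<subseteq> {0<..}"
  shows "0 < prod_list xs \<and> ln (prod_list xs) = (\<Sum>x\<leftarrow>xs. ln (x::real))"
  using assms by (induction xs) (auto simp: ln_mult)

text \<open>In logarithmic form the geometric mean is handled like the other power means, with sums
  of \<open>ln x\<close> in place of sums of powers.\<close>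

lemma power_mean_0:
  assumes "xs \<noteq> []" "set xs \<subseteq> {0<..}"
  shows "power_mean 0 xs = exp ((\<Sum>x\<leftarrow>xs. ln x) / real (length xs))"
  using ln_prod_list[OF assms(2)] assms(1)
  by (simp add: power_mean_def root_powr_inverse powr_def field_simps)

lemma sum_list_powr_pos:
  fixes xs :: "real list"
  assumes "xs \<noteq> []" "set xs \<subseteq> {0<..}"
  shows "0 < (\<Sum>x\<leftarrow>xs. x powr \<alpha>)"
  using assms
proof (induction xs)
  case (Cons a xs)
  have "0 \<le> (\<Sum>x\<leftarrow>xs. x powr \<alpha>)"
    by (rule sum_list_nonneg) auto
  then show ?case
    using Cons.prems by (auto intro!: add_pos_nonneg)
qed auto

lemma power_mean_pos:
  assumes "xs \<noteq> []" "set xs \<subseteq> {0<..}"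
  shows "0 < power_mean \<alpha> xs"
  using assms sum_list_powr_pos[OF assms, of \<alpha>] power_mean_0[OF assms]
  by (cases "\<alpha> = 0") (simp_all add: power_mean_def)

lemma power_mean_le:
  assumes "xs \<noteq> []" "set xs \<subseteq> {0<..X}"
  shows "power_mean \<alpha> xs \<le> X"
proof -
  define n where "n = real (length xs)"
  have n: "n > 0" using assms by (simp add: n_def)
  have pos: "set xs \<subseteq> {0<..}" using assms by auto
  have X: "X > 0" using assms by (cases xs) auto
  note S = sum_list_powr_pos[OF assms(1) pos, of \<alpha>]
  consider "\<alpha> = 0" | "\<alpha> > 0" | "\<alpha> < 0" by linarith
  then show ?thesis
  proof cases
    case 1
    have "(\<Sum>x\<leftarrow>xs. ln x) \<le> n * ln X"
      unfolding n_def using assms(2) by (intro sum_list_map_le) auto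
    then have "(\<Sum>x\<leftarrow>xs. ln x) / n \<le> ln X"
      using n by (simp add: field_simps)
    then have "exp ((\<Sum>x\<leftarrow>xs. ln x) / n) \<le> exp (ln X)" by simp
    then show ?thesis
      using 1 X power_mean_0[OF assms(1) pos] by (simp add: n_def)
  next
    case 2
    have "(\<Sum>x\<leftarrow>xs. x powr \<alpha>) \<le> n * X powr \<alpha>"
      unfolding n_def using assms(2) 2 by (intro sum_list_map_le powr_mono2) auto
    then have "((\<Sum>x\<leftarrow>xs. x powr \<alpha>) / n) powr (1/\<alpha>) \<le> (X powr \<alpha>) powr (1/\<alpha>)"
      using n 2 S by (intro powr_mono2) (auto simp: field_simps)
    then show ?thesis using 2 X by (simp add: power_mean_def powr_powr n_def)
  next
    case 3
    \<comment> \<open>For a negative exponent the sum needs a lower bound, since the outer power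
      \<open>1/\<alpha>\<close> reverses the order once more. Negation turns this into an upper
      bound.\<close>
    have "(\<Sum>x\<leftarrow>xs. - (x powr \<alpha>)) \<le> n * - (X powr \<alpha>)"
      unfolding n_def using assms(2) 3 by (intro sum_list_map_le) (auto intro!: powr_mono2')
    then have "n * X powr \<alpha> \<le> (\<Sum>x\<leftarrow>xs. x powr \<alpha>)"
      by (simp add: sum_list_map_uminus)
    then have "((\<Sum>x\<leftarrow>xs. x powr \<alpha>) / n) powr (1/\<alpha>) \<le> (X powr \<alpha>) powr (1/\<alpha>)"
      using n 3 S X by (intro powr_mono2') (auto simp: field_simps)
    then show ?thesis using 3 X by (simp add: power_mean_def powr_powr n_def)
  qed
qed

text \<open>The factor is the power mean of \<open>r\<close> and \<open>n - 1\<close> ones.\<close>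

definition spread_factor :: "real \<Rightarrow> nat \<Rightarrow> real \<Rightarrow> real" where
  "spread_factor \<alpha> n r =
     (if \<alpha> = 0 then r powr (1 / real n) else (1 + (r powr \<alpha> - 1) / real n) powr (1 / \<alpha>))"

text \<open>Lowering \<open>y\<close> to \<open>r * m\<close> and every other entry to
  \<open>m\<close> can only decrease a power mean, and homogeneity takes out the scale
  \<open>m\<close>.\<close>

lemma power_mean_ge_spread_factor:
  assumes "0 < m" "1 \<le> r" "set xs \<subseteq> {m..}" "y \<in> set xs" "r * m \<le> y"
  shows "spread_factor \<alpha> (length xs) r * m \<le> power_mean \<alpha> xs"
proof -
  define n where "n = real (length xs)"
  have ne: "xs \<noteq> []" using assms by auto
  then have n: "n \<ge> 1" by (cases xs) (auto simp: n_def)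
  have pos: "set xs \<subseteq> {0<..}" using assms by auto
  note S = sum_list_powr_pos[OF ne pos, of \<alpha>]
  \<comment> \<open>Used with \<open>\<rho> = r powr \<alpha>\<close> and
    \<open>M = m powr \<alpha>\<close>: the right side averages the \<open>\<alpha>\<close>-th
    powers of one entry \<open>r * m\<close> and \<open>n - 1\<close> entries
    \<open>m\<close>.\<close>
  have factor: "(1 + (\<rho> - 1) / n) * M = (\<rho> * M + (n - 1) * M) / n" for \<rho> M
    using n by (simp add: field_simps)
  consider "\<alpha> = 0" | "\<alpha> > 0" | "\<alpha> < 0" by linarith
  then show ?thesis
  proof cases
    case 1
    have "ln y + (n - 1) * ln m \<le> (\<Sum>x\<leftarrow>xs. ln x)"
      unfolding n_def using assms by (intro sum_list_map_ge) auto
    moreover have "ln (r * m) \<le> ln y"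
      using assms by (subst ln_le_cancel_iff) (auto intro: less_le_trans)
    ultimately have "ln r + n * ln m \<le> (\<Sum>x\<leftarrow>xs. ln x)"
      using assms by (simp add: ln_mult algebra_simps)
    then have "(ln r + n * ln m) / n \<le> (\<Sum>x\<leftarrow>xs. ln x) / n"
      using n by (intro divide_right_mono) auto
    then have "ln r / n + ln m \<le> (\<Sum>x\<leftarrow>xs. ln x) / n"
      using n by (simp add: add_divide_distrib)
    then have "exp (ln r / n + ln m) \<le> exp ((\<Sum>x\<leftarrow>xs. ln x) / n)" by simp
    then show ?thesis
      using 1 assms power_mean_0[OF ne pos] n
      by (simp add: n_def spread_factor_def exp_add powr_def)
  next
    case 2
    have "y powr \<alpha> + (n - 1) * m powr \<alpha> \<le> (\<Sum>x\<leftarrow>xs. x powr \<alpha>)"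
      unfolding n_def using assms 2 by (intro sum_list_map_ge powr_mono2) auto
    moreover have "(r * m) powr \<alpha> \<le> y powr \<alpha>"
      using assms 2 by (intro powr_mono2) auto
    ultimately have "(1 + (r powr \<alpha> - 1) / n) * m powr \<alpha> \<le> (\<Sum>x\<leftarrow>xs. x powr \<alpha>) / n"
      unfolding factor using n assms by (intro divide_right_mono) (auto simp: powr_mult)
    moreover have f: "0 \<le> 1 + (r powr \<alpha> - 1) / n"
      using n 2 assms by (simp add: ge_one_powr_ge_zero)
    ultimately have "((1 + (r powr \<alpha> - 1) / n) * m powr \<alpha>) powr (1/\<alpha>)
        \<le> ((\<Sum>x\<leftarrow>xs. x powr \<alpha>) / n) powr (1/\<alpha>)"
      using 2 by (intro powr_mono2) auto
    then show ?thesis using 2 assms f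
      by (simp add: power_mean_def powr_powr n_def spread_factor_def powr_mult)
  next
    case 3
    have "- (y powr \<alpha>) + (n - 1) * - (m powr \<alpha>) \<le> (\<Sum>x\<leftarrow>xs. - (x powr \<alpha>))"
      unfolding n_def using assms 3 by (intro sum_list_map_ge) (auto intro!: powr_mono2')
    moreover have "y powr \<alpha> \<le> (r * m) powr \<alpha>"
      using assms 3 by (intro powr_mono2') auto
    ultimately have "(\<Sum>x\<leftarrow>xs. x powr \<alpha>) / n \<le> (1 + (r powr \<alpha> - 1) / n) * m powr \<alpha>"
      unfolding factor using n assms
      by (intro divide_right_mono) (auto simp: powr_mult sum_list_map_uminus)
    moreover have f: "0 \<le> 1 + (r powr \<alpha> - 1) / n"
    proof -
      have "0 \<le> (n - 1 + r powr \<alpha>) / n" using n by simp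
      also have "\<dots> = 1 + (r powr \<alpha> - 1) / n" using n by (simp add: field_simps)
      finally show ?thesis .
    qed
    ultimately have "((1 + (r powr \<alpha> - 1) / n) * m powr \<alpha>) powr (1/\<alpha>)
        \<le> ((\<Sum>x\<leftarrow>xs. x powr \<alpha>) / n) powr (1/\<alpha>)"
      using 3 S n by (intro powr_mono2') auto
    then show ?thesis using 3 assms f
      by (simp add: power_mean_def powr_powr n_def spread_factor_def powr_mult)
  qed
qed

text \<open>A single entry above the minimum lifts every power mean strictly. For a negative
  exponent the base falls into the interval from 0 to 1, but is then raised to a negative
  power.\<close>

lemma spread_factor_gt_1:
  assumes "1 < r" "0 < n"
  shows "1 < spread_factor \<alpha> n r"
proof -
  consider "\<alpha> = 0" | "\<alpha> > 0" | "\<alpha> < 0" by linarith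
  then show ?thesis
  proof cases
    case 1
    then show ?thesis using assms by (simp add: spread_factor_def gr_one_powr)
  next
    case 2
    then show ?thesis using assms by (simp add: spread_factor_def gr_one_powr)
  next
    case 3
    have "r powr \<alpha> < 1" using powr_less_mono[of \<alpha> 0 r] 3 assms by simp
    moreover have "0 < (real n - 1 + r powr \<alpha>) / real n" using assms by (simp add: add_nonneg_pos)
    then have f: "0 < 1 + (r powr \<alpha> - 1) / real n" using assms by (simp add: field_simps)
    ultimately have "(1 + (r powr \<alpha> - 1) / real n) powr (1/\<alpha>) > 1 powr (1/\<alpha>)"
      using 3 assms by (intro powr_less_mono2_neg) (auto simp: field_simps)
    then show ?thesis using 3 by (simp add: spread_factor_def)
  qed
qed

text \<open>This is the degenerate case \<open>r = 1\<close>, where the spread factor is 1.\<close>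

lemma power_mean_ge:
  assumes "0 < m" "xs \<noteq> []" "set xs \<subseteq> {m..}"
  shows "m \<le> power_mean \<alpha> xs"
proof -
  have "spread_factor \<alpha> (length xs) 1 * m \<le> power_mean \<alpha> xs"
    using assms hd_in_set[OF assms(2)] subsetD[OF assms(3), of "hd xs"]
    by (intro power_mean_ge_spread_factor[where y = "hd xs"]) auto
  moreover have "spread_factor \<alpha> (length xs) 1 = 1"
    by (simp add: spread_factor_def)
  ultimately show ?thesis by simp
qed

text \<open>The gain is uniform: there are finitely many exponents, and each spread factor depends
  on \<open>n\<close> and \<open>r\<close> but not on the vector, so their minimum still exceeds
  1.\<close>

lemma power_means_expand:
  assumes "1 < r" "0 < n"
  obtains \<kappa> where "1 < \<kappa>"
    "\<And>\<alpha> m xs y. \<lbrakk>\<alpha> \<in> set lam; length xs = n; 0 < m; set xs \<subseteq> {m..}; y \<in> set xs; r * m \<le> y\<rbrakk>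
       \<Longrightarrow> \<kappa> * m \<le> power_mean \<alpha> xs"
proof
  \<comment> \<open>The extra element 2, itself above 1, keeps the set nonempty when
    \<open>lam\<close> is empty.\<close>
  let ?K = "insert 2 ((\<lambda>\<alpha>. spread_factor \<alpha> n r) ` set lam)"
  show "1 < Min ?K"
    using spread_factor_gt_1[OF assms] by auto
  show "Min ?K * m \<le> power_mean \<alpha> xs"
    if "\<alpha> \<in> set lam" "length xs = n" "0 < m" "set xs \<subseteq> {m..}" "y \<in> set xs" "r * m \<le> y"
    for \<alpha> m xs y
  proof -
    have "Min ?K \<le> spread_factor \<alpha> n r" using that by (intro Min_le) auto
    then have "Min ?K * m \<le> spread_factor \<alpha> n r * m" using that by simp
    also have "\<dots> \<le> power_mean \<alpha> xs"
      using power_mean_ge_spread_factor[of m r xs y \<alpha>] that assms by simp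
    finally show ?thesis .
  qed
qed

text \<open>Dropping all terms but one leaves \<open>y\<close> over the \<open>\<alpha>\<close>-th
  root of the length, and for \<open>\<alpha> \<ge> 1\<close> this root is at most the length. Here
  the threshold 1 enters the lower bound.\<close>

lemma power_mean_ge_divide_length:
  assumes "1 \<le> \<alpha>" "set xs \<subseteq> {0<..}" "y \<in> set xs"
  shows "y / real (length xs) \<le> power_mean \<alpha> xs"
proof -
  have y: "y > 0" using assms by auto
  have n: "real (length xs) \<ge> 1" using assms(3) by (cases xs) auto
  have "y powr \<alpha> + (real (length xs) - 1) * 0 \<le> (\<Sum>x\<leftarrow>xs. x powr \<alpha>)"
    using assms by (intro sum_list_map_ge) auto
  then have "(y powr \<alpha> / real (length xs)) powr (1/\<alpha>) \<le> power_mean \<alpha> xs"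
    using assms n unfolding power_mean_def by (auto intro!: powr_mono2 divide_right_mono)
  moreover have "(y powr \<alpha> / real (length xs)) powr (1/\<alpha>) = y / real (length xs) powr (1/\<alpha>)"
    using assms y by (simp add: powr_divide powr_powr)
  moreover have "real (length xs) powr (1/\<alpha>) \<le> real (length xs) powr 1"
    using n assms by (intro powr_mono) auto
  then have "y / real (length xs) \<le> y / real (length xs) powr (1/\<alpha>)"
    using y n by (intro divide_left_mono mult_pos_pos) auto
  ultimately show ?thesis by linarith
qed

text \<open>Summing the tangent inequality \<open>exp t \<ge> exp c * (1 + t - c)\<close> at the average \<open>c\<close> of the \<open>t\<close>.\<close>

lemma exp_average_ln_le:
  fixes xs :: "real list"
  assumes "xs \<noteq> []" "set xs \<subseteq> {0<..}"
  shows "exp (\<mu> * ((\<Sum>x\<leftarrow>xs. ln x) / real (length xs)))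
    \<le> (\<Sum>x\<leftarrow>xs. x powr \<mu>) / real (length xs)"
proof -
  define n where "n = real (length xs)"
  have n: "n > 0" using assms by (simp add: n_def)
  define c where "c = \<mu> * ((\<Sum>x\<leftarrow>xs. ln x) / n)"
  have "(\<Sum>x\<leftarrow>xs. exp c * (1 - c) + exp c * \<mu> * ln x) \<le> (\<Sum>x\<leftarrow>xs. x powr \<mu>)"
  proof (rule sum_list_mono)
    fix x assume "x \<in> set xs"
    then have "x powr \<mu> = exp c * exp (\<mu> * ln x - c)"
      using assms by (auto simp: powr_def simp flip: exp_add)
    moreover have "exp c * (1 + (\<mu> * ln x - c)) \<le> exp c * exp (\<mu> * ln x - c)"
      by (intro mult_left_mono) auto
    ultimately show "exp c * (1 - c) + exp c * \<mu> * ln x \<le> x powr \<mu>"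
      by (simp add: algebra_simps)
  qed
  also have "(\<Sum>x\<leftarrow>xs. exp c * (1 - c) + exp c * \<mu> * ln x)
      = n * (exp c * (1 - c)) + exp c * \<mu> * (\<Sum>x\<leftarrow>xs. ln x)"
    by (simp add: sum_list_addf sum_list_triv sum_list_const_mult n_def)
  also have "\<dots> = n * exp c"
  proof -
    have "\<mu> * (\<Sum>x\<leftarrow>xs. ln x) = n * c"
      using n by (simp add: c_def)
    then have "exp c * \<mu> * (\<Sum>x\<leftarrow>xs. ln x) = exp c * (n * c)"
      by (simp add: mult.assoc)
    then show ?thesis by (simp add: algebra_simps)
  qed
  finally have "n * exp c \<le> (\<Sum>x\<leftarrow>xs. x powr \<mu>)" .
  then have "exp c \<le> (\<Sum>x\<leftarrow>xs. x powr \<mu>) / n"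
    using n by (simp add: field_simps)
  then show ?thesis by (simp add: c_def n_def)
qed

text \<open>The geometric mean \<open>exp c\<close> separates the two sides. Both comparisons come
  from the same inequality, taken at \<open>\<alpha>\<close> and at \<open>\<mu>\<close>; the root
  \<open>1/\<alpha>\<close> reverses it when \<open>\<alpha>\<close> is negative.\<close>

lemma power_mean_le_pos_exponent:
  assumes "xs \<noteq> []" "set xs \<subseteq> {0<..}" "\<alpha> \<le> 0" "0 < \<mu>"
  shows "power_mean \<alpha> xs \<le> power_mean \<mu> xs"
proof -
  define c where "c = (\<Sum>x\<leftarrow>xs. ln x) / real (length xs)"
  have *: "exp (\<nu> * c) \<le> (\<Sum>x\<leftarrow>xs. x powr \<nu>) / real (length xs)" for \<nu>
    using exp_average_ln_le[OF assms(1,2)] by (simp add: c_def)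
  have "power_mean \<alpha> xs \<le> exp c"
  proof (cases "\<alpha> = 0")
    case True
    then show ?thesis using power_mean_0[OF assms(1,2)] by (simp add: c_def)
  next
    case False
    have "power_mean \<alpha> xs \<le> exp (\<alpha> * c) powr (1/\<alpha>)"
      using False assms *[of \<alpha>] unfolding power_mean_def by (auto intro!: powr_mono2')
    then show ?thesis using False by (simp add: powr_def)
  qed
  also have "exp c = exp (\<mu> * c) powr (1/\<mu>)" using assms by (simp add: powr_def)
  also have "\<dots> \<le> power_mean \<mu> xs"
    using assms *[of \<mu>] unfolding power_mean_def by (auto intro!: powr_mono2)
  finally show ?thesis .
qed

subsection \<open>Convergence of the Gaussian iteration\<close>

lemma gauss_iter_Suc:
  "gauss_iter lam v (Suc i) = map (\<lambda>\<alpha>. power_mean \<alpha> (gauss_iter lam v i)) lam"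
  by (simp add: gauss_iter_def)

lemma length_gauss_iter_Suc [simp]: "length (gauss_iter lam v (Suc i)) = length lam"
  by (simp add: gauss_iter_Suc)

lemma gauss_iter_pos:
  assumes "lam \<noteq> []" "v \<noteq> []" "set v \<subseteq> {0<..}"
  shows "gauss_iter lam v i \<noteq> [] \<and> set (gauss_iter lam v i) \<subseteq> {0<..}"
proof (induction i)
  case 0
  then show ?case using assms by (simp add: gauss_iter_def)
next
  case (Suc i)
  then show ?case
    using assms(1) power_mean_pos by (auto simp: gauss_iter_Suc)
qed

text \<open>Power means lie between the smallest and the largest entry, so an enclosing interval is
  never left.\<close>

lemma gauss_iter_bounds:
  assumes "lam \<noteq> []" "v \<noteq> []" "0 < a" "i \<le> j" "set (gauss_iter lam v i) \<subseteq> {a..b}"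
    "set v \<subseteq> {0<..}"
  shows "set (gauss_iter lam v j) \<subseteq> {a..b}"
  using assms(4)
proof (induction rule: dec_induct)
  case base
  show ?case by fact
next
  case (step j)
  let ?w = "gauss_iter lam v j"
  have w: "?w \<noteq> []" using gauss_iter_pos assms by blast
  have "a \<le> power_mean \<alpha> ?w" "power_mean \<alpha> ?w \<le> b" for \<alpha>
    using step.IH w assms(3) by (intro power_mean_ge power_mean_le; force)+
  then show ?case by (auto simp: gauss_iter_Suc)
qed

text \<open>The minima increase and the maxima decrease. If their ratio stayed above some
  \<open>r > 1\<close>, each step would multiply the minimum by a fixed factor above 1, which the
  first maximum forbids. Hence both have the same limit, and the description in
  \<open>gauss_product\<close> is well defined.\<close>

lemma gauss_product_tendsto:
  assumes "lam \<noteq> []" "v \<noteq> []" "set v \<subseteq> {0<..}" "k < length lam"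
  shows "(\<lambda>i. gauss_iter lam v (Suc i) ! k) \<longlonglongrightarrow> gauss_product lam v"
proof -
  \<comment> \<open>From the first iterate on, all vectors have the length of \<open>lam\<close>, so
    one expansion factor serves every step.\<close>
  define w where "w i = gauss_iter lam v (Suc i)" for i
  define m where "m i = Min (set (w i))" for i
  define X where "X i = Max (set (w i))" for i
  have w: "w i \<noteq> []" "set (w i) \<subseteq> {0<..}" "length (w i) = length lam" for i
    unfolding w_def by (simp_all only: gauss_iter_pos[OF assms(1-3)] length_gauss_iter_Suc not_False_eq_True)
  have wk: "set (w i) \<subseteq> {m i..X i}" for i
    by (auto simp: m_def X_def)
  have mX: "m i \<in> set (w i)" "X i \<in> set (w i)" for i
    using w by (auto simp: m_def X_def)
  then have m_pos: "0 < m i" for i using w(2) by fastforce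
  have mono: "set (w j) \<subseteq> {m i..X i}" if "i \<le> j" for i j
  proof -
    have "set (gauss_iter lam v (Suc i)) \<subseteq> {m i..X i}" using wk[of i] unfolding w_def .
    with assms(1,2) m_pos[of i] _ show ?thesis
      unfolding w_def by (rule gauss_iter_bounds) (use that assms(3) in simp_all)
  qed
  have m_mono: "m i \<le> m j" and X_mono: "X j \<le> X i" if "i \<le> j" for i j
    using subsetD[OF mono[OF that] mX(1)] subsetD[OF mono[OF that] mX(2)] by simp_all
  then have "incseq m" "decseq X"
    by (simp_all add: incseq_def decseq_def)
  have bound: "m i \<le> X j" for i j
  proof -
    have "m i \<le> m (max i j)" by (rule m_mono) simp
    also have "\<dots> \<le> X (max i j)" using subsetD[OF wk mX(2)] by simp
    also have "\<dots> \<le> X j" by (rule X_mono) simp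
    finally show ?thesis .
  qed
  obtain L where L: "m \<longlonglongrightarrow> L" "\<And>i. m i \<le> L"
    using incseq_convergent[OF \<open>incseq m\<close>, of "X 0"] bound by blast
  have LX: "L \<le> X j" for j
    using L(1) bound by (intro LIMSEQ_le_const2) auto
  have L_pos: "0 < L" using L(2)[of 0] m_pos[of 0] by simp
  have close: "\<exists>i. X i < r * m i" if r: "1 < r" for r
  proof (rule ccontr)
    assume "\<not> ?thesis"
    then have big: "r * m i \<le> X i" for i by (simp add: not_less)
    obtain \<kappa> where \<kappa>: "1 < \<kappa>" and
      expand: "\<And>\<alpha> m xs y. \<lbrakk>\<alpha> \<in> set lam; length xs = length lam; 0 < m; set xs \<subseteq> {m..};
        y \<in> set xs; r * m \<le> y\<rbrakk> \<Longrightarrow> \<kappa> * m \<le> power_mean \<alpha> xs"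
      using power_means_expand[OF r, of "length lam"] assms(1) by auto
    have grow: "\<kappa> * m i \<le> m (Suc i)" for i
    proof -
      have "\<kappa> * m i \<le> power_mean \<alpha> (w i)" if "\<alpha> \<in> set lam" for \<alpha>
        using that w(3) m_pos wk[of i] mX big by (intro expand[of _ _ _ "X i"]) auto
      moreover have "w (Suc i) = map (\<lambda>\<alpha>. power_mean \<alpha> (w i)) lam"
        by (simp add: w_def gauss_iter_Suc)
      ultimately show ?thesis using mX(1)[of "Suc i"] by auto
    qed
    have pow: "\<kappa> ^ i * m 0 \<le> m i" for i
    proof (induction i)
      case (Suc i)
      have "\<kappa> ^ Suc i * m 0 \<le> \<kappa> * m i"
        using Suc \<kappa> by (simp add: mult.assoc)
      also have "\<dots> \<le> m (Suc i)" by (rule grow)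
      finally show ?case .
    qed auto
    obtain i where "X 0 / m 0 < \<kappa> ^ i" using real_arch_pow[OF \<kappa>] by blast
    then have "X 0 < \<kappa> ^ i * m 0" using m_pos[of 0] by (simp add: field_simps)
    then show False using pow[of i] bound[of i 0] by linarith
  qed
  have X: "X \<longlonglongrightarrow> L"
  proof (rule LIMSEQ_I)
    fix e :: real assume e: "0 < e"
    \<comment> \<open>This ratio is chosen so that \<open>m i \<le> L\<close> turns the bound into
      \<open>L + e\<close>.\<close>
    obtain i where "X i < (1 + e / L) * m i" using close[of "1 + e / L"] e L_pos by auto
    also have "\<dots> \<le> (1 + e / L) * L" using e L_pos L(2) by (intro mult_left_mono) auto
    also have "\<dots> = L + e" using L_pos by (simp add: field_simps)
    finally have i: "X i < L + e" .
    have "norm (X j - L) < e" if "i \<le> j" for j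
      using i LX[of j] decseqD[OF \<open>decseq X\<close> that] by simp
    then show "\<exists>i. \<forall>j\<ge>i. norm (X j - L) < e" by blast
  qed
  have lim: "(\<lambda>i. w i ! k) \<longlonglongrightarrow> L" if "k < length lam" for k
  proof (rule tendsto_sandwich[OF _ _ L(1) X])
    have "w i ! k \<in> {m i..X i}" for i 
      using subsetD[OF wk[of i] nth_mem] that w(3)[of i] by simp
    then show "\<forall>\<^sub>F i in sequentially. m i \<le> w i ! k" "\<forall>\<^sub>F i in sequentially. w i ! k \<le> X i"
      by (auto intro!: always_eventually)
  qed
  have "gauss_product lam v = L"
    unfolding gauss_product_def
  proof (rule the_equality)
    show "\<forall>k<length lam. (\<lambda>i. gauss_iter lam v (Suc i) ! k) \<longlonglongrightarrow> L"
      using lim by (simp add: w_def)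
    fix L' assume "\<forall>k<length lam. (\<lambda>i. gauss_iter lam v (Suc i) ! k) \<longlonglongrightarrow> L'"
    then show "L' = L"
      using lim[OF assms(4)] assms(4) LIMSEQ_unique by (fastforce simp: w_def)
  qed
  then show ?thesis using lim[OF assms(4)] by (simp add: w_def)
qed

text \<open>The iterates stay in the interval from this stage on, and closedness passes the bounds
  to the limit.\<close>

lemma gauss_product_between:
  assumes "lam \<noteq> []" "v \<noteq> []" "set v \<subseteq> {0<..}" "0 < a" "set (gauss_iter lam v (Suc i)) \<subseteq> {a..b}"
  shows "gauss_product lam v \<in> {a..b}"
proof -
  have k: "0 < length lam" using assms by simp
  have "gauss_iter lam v (Suc j) ! 0 \<in> {a..b}" if "i \<le> j" for j
  proof -
    have "gauss_iter lam v (Suc j) ! 0 \<in> set (gauss_iter lam v (Suc j))"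
      using k by (intro nth_mem) simp
    moreover have "set (gauss_iter lam v (Suc j)) \<subseteq> {a..b}"
      by (rule gauss_iter_bounds[OF assms(1,2,4) _ assms(5,3)]) (use that in simp)
    ultimately show ?thesis by blast
  qed
  then have "\<forall>\<^sub>F j in sequentially. gauss_iter lam v (Suc j) ! 0 \<in> {a..b}"
    by (rule eventually_sequentiallyI)
  then show ?thesis
    by (rule Lim_in_closed_set[OF closed_atLeastAtMost _ sequentially_bot
          gauss_product_tendsto[OF assms(1-3) k]])
qed

lemma gauss_product_ge:
  assumes "lam \<noteq> []" "v \<noteq> []" "set v \<subseteq> {0<..}" "0 < a" "set (gauss_iter lam v (Suc i)) \<subseteq> {a..}"
  shows "a \<le> gauss_product lam v"
proof -
  have "set (gauss_iter lam v (Suc i)) \<subseteq> {a..Max (set (gauss_iter lam v (Suc i)))}"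
    using assms(5) by auto
  then show ?thesis using gauss_product_between[OF assms(1-4)] by force
qed

lemma gauss_product_pos:
  assumes "lam \<noteq> []" "v \<noteq> []" "set v \<subseteq> {0<..}"
  shows "0 < gauss_product lam v"
proof -
  have *: "gauss_iter lam v 1 \<noteq> []" "set (gauss_iter lam v 1) \<subseteq> {0<..}"
    using gauss_iter_pos[OF assms] by auto
  then have "Min (set (gauss_iter lam v 1)) \<in> {0<..}"
    using Min_in[of "set (gauss_iter lam v 1)"] by auto
  then show ?thesis using gauss_product_ge[OF assms, of "Min (set (gauss_iter lam v 1))" 0]
    by (fastforce simp: subset_iff)
qed

text \<open>The first iterate consists of the power means of \<open>v\<close>, each at most the sum
  because all are positive. The sum replaces the maximum since Hardy means are closed under finite
  sums.\<close>

lemma gauss_product_le_sum_power_means: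
  assumes "lam \<noteq> []" "v \<noteq> []" "set v \<subseteq> {0<..}"
  shows "gauss_product lam v \<le> (\<Sum>\<alpha>\<in>set lam. power_mean \<alpha> v)"
proof -
  have pos: "0 < power_mean \<alpha> v" for \<alpha> using power_mean_pos assms by blast
  have "power_mean \<alpha> v \<in> {Min ((\<lambda>\<alpha>. power_mean \<alpha> v) ` set lam)..\<Sum>\<alpha>\<in>set lam. power_mean \<alpha> v}"
    if "\<alpha> \<in> set lam" for \<alpha>
    using that pos by (auto intro!: member_le_sum Min_le intro: less_imp_le)
  then have "set (gauss_iter lam v (Suc 0)) \<subseteq>
      {Min ((\<lambda>\<alpha>. power_mean \<alpha> v) ` set lam)..\<Sum>\<alpha>\<in>set lam. power_mean \<alpha> v}"
    by (auto simp: gauss_iter_Suc gauss_iter_def)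
  moreover have "0 < Min ((\<lambda>\<alpha>. power_mean \<alpha> v) ` set lam)"
    using pos assms by simp
  ultimately show ?thesis
    using gauss_product_between[OF assms] by force
qed

subsection \<open>A lower bound when some exponent is at least one\<close>

text \<open>Each step multiplies the smallest coordinate by at least \<open>\<kappa>\<close> as long as the coordinates
  are spread out, whereas the mean with exponent \<open>\<ge> 1\<close> divides the largest one by at most
  \<open>length lam\<close>.\<close>

lemma gauss_product_ge_geometric:
  assumes "\<beta> \<in> set lam" "1 \<le> \<beta>" "v \<noteq> []" "set v \<subseteq> {0<..}"
    and "1 < \<kappa>" "real (length lam) * \<kappa> \<le> q"
    and expand: "\<And>\<alpha> m xs y. \<lbrakk>\<alpha> \<in> set lam; length xs = length lam; 0 < m; set xs \<subseteq> {m..};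
        y \<in> set xs; 2 * m \<le> y\<rbrakk> \<Longrightarrow> \<kappa> * m \<le> power_mean \<alpha> xs"
    and "0 < m" "set (gauss_iter lam v (Suc i)) \<subseteq> {m..}"
    and "y \<in> set (gauss_iter lam v (Suc i))" "2 * q ^ k * m \<le> y"
  shows "\<kappa> ^ k * m \<le> gauss_product lam v"
  using assms(8-11)
proof (induction k arbitrary: i m y)
  case 0
  have "lam \<noteq> []" using assms(1) by auto
  then show ?case using gauss_product_ge[OF _ assms(3,4) 0(1,2)] by simp
next
  case (Suc k)
  let ?w = "gauss_iter lam v (Suc i)"
  have n: "1 \<le> real (length lam)" using assms(1) by (cases lam) auto
  have q: "1 \<le> q" using mult_mono[OF n less_imp_le[OF assms(5)]] assms(6) by simp
  have "1 * (2 * m) \<le> q ^ Suc k * (2 * m)"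
    using q Suc.prems(1) by (intro mult_right_mono one_le_power) auto
  then have two: "2 * m \<le> y" using Suc.prems(4) by (simp add: mult_ac)
  have step: "gauss_iter lam v (Suc (Suc i)) = map (\<lambda>\<alpha>. power_mean \<alpha> ?w) lam"
    by (rule gauss_iter_Suc)
  have "\<kappa> ^ k * (\<kappa> * m) \<le> gauss_product lam v"
  \<comment> \<open>The induction is on the guaranteed spread: as
    \<open>length lam * \<kappa> \<le> q\<close>, one step uses up at most one factor
    \<open>q\<close>. The number \<open>m\<close> is only a lower bound, so a faster growth of the
    true minimum does no harm.\<close>
  proof (rule Suc.IH)
    show "0 < \<kappa> * m" using assms(5) Suc.prems(1) by simp
    show "set (gauss_iter lam v (Suc (Suc i))) \<subseteq> {\<kappa> * m..}"
      unfolding step using expand[OF _ length_gauss_iter_Suc Suc.prems(1-3) two] by auto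
    show "power_mean \<beta> ?w \<in> set (gauss_iter lam v (Suc (Suc i)))"
      unfolding step using assms(1) by auto
    have "set ?w \<subseteq> {0<..}" using Suc.prems(1,2) by auto
    then have "y / real (length lam) \<le> power_mean \<beta> ?w"
      using power_mean_ge_divide_length[OF assms(2) _ Suc.prems(3)] by simp
    moreover have "2 * q ^ k * (\<kappa> * m) \<le> y / real (length lam)"
    proof -
      have "2 * q ^ k * (\<kappa> * m) * real (length lam) = 2 * q ^ k * m * (real (length lam) * \<kappa>)"
        by (simp add: mult_ac)
      also have "\<dots> \<le> 2 * q ^ k * m * q"
        using assms(6) q Suc.prems(1) by (intro mult_left_mono) auto
      also have "\<dots> \<le> y" using Suc.prems(4) by (simp add: mult_ac)
      finally show ?thesis using n by (subst pos_le_divide_eq) auto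
    qed
    ultimately show "2 * q ^ k * (\<kappa> * m) \<le> power_mean \<beta> ?w" by linarith
  qed
  then show ?case by (simp add: mult_ac)
qed

text \<open>The mean with exponent \<open>\<beta>\<close> makes the first iterate contain an entry
  at least \<open>z = y / length v\<close>. About \<open>log q (z / m)\<close> expanding steps then
  follow, and \<open>\<kappa> ^ k = (q ^ k) powr \<theta>\<close> turns their total gain into a
  power of \<open>z / m\<close>. Both \<open>\<theta>\<close> and \<open>c\<close> are independent
  of \<open>v\<close>.\<close>

lemma gauss_product_ge_powr:
  assumes "\<beta> \<in> set lam" "1 \<le> \<beta>"
  obtains \<theta> c where "0 < \<theta>" "\<theta> < 1" "0 < c"
    "\<And>v m y. \<lbrakk>set v \<subseteq> {m..}; y \<in> set v; 0 < m\<rbrakk> \<Longrightarrow>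
      c * m * (y / real (length v) / m) powr \<theta> \<le> gauss_product lam v"
proof -
  have ne: "lam \<noteq> []" using assms by auto
  obtain \<kappa> where \<kappa>: "1 < \<kappa>" and
    expand: "\<And>\<alpha> m xs y. \<lbrakk>\<alpha> \<in> set lam; length xs = length lam; 0 < m; set xs \<subseteq> {m..};
      y \<in> set xs; 2 * m \<le> y\<rbrakk> \<Longrightarrow> \<kappa> * m \<le> power_mean \<alpha> xs"
    using power_means_expand[of 2 "length lam"] ne by auto
  \<comment> \<open>The successor makes \<open>q\<close> exceed \<open>\<kappa>\<close> strictly
    even for a single exponent, which gives \<open>\<theta> < 1\<close>.\<close>
  define q where "q = real (Suc (length lam)) * \<kappa>"
  have "1 * \<kappa> < q" using ne \<kappa> unfolding q_def by (intro mult_strict_right_mono) auto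
  then have q: "\<kappa> < q" "1 < q" using \<kappa> by auto
  define \<theta> where "\<theta> = ln \<kappa> / ln q"
  have \<theta>: "0 < \<theta>" "\<theta> < 1" using \<kappa> q by (auto simp: \<theta>_def)
  have q\<theta>: "q powr \<theta> = \<kappa>" using q \<kappa> by (simp add: \<theta>_def powr_def)
  \<comment> \<open>The factor \<open>\<kappa>\<close> pays for rounding the number of steps down,
    and \<open>2 powr \<theta>\<close> for the spread 2 that must remain at the last step.\<close>
  define c where "c = 1 / (\<kappa> * 2 powr \<theta>)"
  have "c * m * (y / real (length v) / m) powr \<theta> \<le> gauss_product lam v"
    if v: "set v \<subseteq> {m..}" "y \<in> set v" "0 < m" for v m y
  proof -
    define z where "z = y / real (length v)"
    have vne: "v \<noteq> []" using v by auto
    have vpos: "set v \<subseteq> {0<..}" using v by auto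
    have z: "0 < z" using v vpos vne by (auto simp: z_def)
    have w: "gauss_iter lam v (Suc 0) = map (\<lambda>\<alpha>. power_mean \<alpha> v) lam"
      by (simp add: gauss_iter_Suc gauss_iter_def)
    have ge: "set (gauss_iter lam v (Suc 0)) \<subseteq> {m..}"
      unfolding w using power_mean_ge[OF v(3) vne v(1)] by auto
    have bnd: "c * m * (z / m) powr \<theta> \<le> \<kappa> ^ k * m" if "z / (2 * m) \<le> q ^ Suc k" for k
    proof -
      have "(z / (2 * m)) powr \<theta> \<le> (q ^ Suc k) powr \<theta>"
        using that z v(3) \<theta> by (intro powr_mono2) auto
      also have "\<dots> = \<kappa> ^ Suc k"
        using q by (induction k) (simp_all add: powr_mult q\<theta>)
      finally have "(z / (2 * m)) powr \<theta> / \<kappa> \<le> \<kappa> ^ k" using \<kappa> by (simp add: field_simps)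
      moreover have "(z / (2 * m)) powr \<theta> / \<kappa> = c * (z / m) powr \<theta>"
        using z v(3) by (simp add: c_def powr_divide powr_mult)
      ultimately show ?thesis using v(3) by (simp add: mult_ac)
    qed
    have "c * m * (z / m) powr \<theta> \<le> gauss_product lam v"
    proof (cases "z / (2 * m) < q")
      case True
      \<comment> \<open>With so little spread no expanding step is required: the claim is already
        below the trivial bound \<open>m\<close>.\<close>
      then have "c * m * (z / m) powr \<theta> \<le> m" using bnd[of 0] by simp
      also have "m \<le> gauss_product lam v"
        using gauss_product_ge[OF ne vne vpos v(3) ge] .
      finally show ?thesis .
    next
      case False
      define t where "t = z / (2 * m)"
      \<comment> \<open>Thus \<open>t\<close> lies between \<open>q ^ k\<close> and
        \<open>q ^ Suc k\<close>: the lower bound allows \<open>k\<close> expanding steps, the upper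
        one is what \<open>bnd\<close> asks for.\<close>
      define k where "k = nat \<lfloor>log q t\<rfloor>"
      have t: "q \<le> t" using False by (simp add: t_def)
      then have "0 \<le> log q t" using q by simp
      then have k: "real k \<le> log q t" "log q t \<le> real (Suc k)" unfolding k_def by linarith+
      have "q ^ k = q powr real k" using q by (simp add: powr_realpow)
      also have "\<dots> \<le> q powr (log q t)" using k q by simp
      also have "\<dots> = t" using q t by simp
      finally have kt: "q ^ k \<le> t" .
      have "t = q powr (log q t)" using q t by simp
      also have "\<dots> \<le> q powr real (Suc k)" using k q by (intro powr_mono) auto
      also have "\<dots> = q ^ Suc k" using q by (subst powr_realpow) auto
      finally have tk: "t \<le> q ^ Suc k" .
      have "\<kappa> ^ k * m \<le> gauss_product lam v"
      proof (rule gauss_product_ge_geometric[OF assms vne vpos \<kappa> _ expand v(3) ge])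
        show "real (length lam) * \<kappa> \<le> q" using \<kappa> by (simp add: q_def)
        show "power_mean \<beta> v \<in> set (gauss_iter lam v (Suc 0))" unfolding w using assms by auto
        have "2 * q ^ k * m \<le> z" using kt v(3) by (simp add: t_def field_simps)
        also have "z \<le> power_mean \<beta> v"
          unfolding z_def by (rule power_mean_ge_divide_length[OF assms(2) vpos v(2)])
        finally show "2 * q ^ k * m \<le> power_mean \<beta> v" .
      qed auto
      then show ?thesis using bnd[of k] tk by (simp add: t_def)
    qed
    then show ?thesis by (simp add: z_def)
  qed
  moreover have "0 < c" using \<kappa> by (simp add: c_def)
  ultimately show thesis using that \<theta> by blast
qed

subsection \<open>The Hardy inequality\<close>

lemma hardy_imp_weak_hardy_mean:
  assumes "hardy_mean I M"
  shows "weak_hardy_mean I M"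
proof -
  obtain C where C: "\<forall>a\<in>l1_seqs I. summable (\<lambda>n. M (map a [0..<Suc n])) \<and>
      (\<Sum>n. M (map a [0..<Suc n])) \<le> C * (\<Sum>n. a n)"
    using assms unfolding hardy_mean_def by (rule exE)
  show ?thesis
    unfolding weak_hardy_mean_def
  proof
    fix a assume "a \<in> l1_seqs I"
    from bspec[OF C this] show "summable (\<lambda>n. M (map a [0..<Suc n]))"
      by (rule conjunct1)
  qed
qed

text \<open>Weighted arithmetic-geometric mean inequality for \<open>x powr q\<close> and
  \<open>y powr q\<close> with weights \<open>(q - 1) / q\<close> and \<open>1 / q\<close>.\<close>

lemma Youngs_inequality_powr:
  fixes x y q :: real
  assumes "1 < q" "0 < x" "0 < y"
  shows "q * (x powr (q - 1) * y) \<le> (q - 1) * x powr q + y powr q"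
proof -
  have "(x powr q) powr ((q - 1) / q) * (y powr q) powr (1 / q)
      \<le> (q - 1) / q * x powr q + 1 / q * y powr q"
    using assms by (intro Youngs_inequality_0) (auto simp: diff_divide_distrib)
  then have "x powr (q - 1) * y \<le> ((q - 1) * x powr q + y powr q) / q"
    using assms by (simp add: powr_powr add_divide_distrib)
  then show ?thesis using assms by (simp add: field_simps)
qed

text \<open>Elliott's proof: Young's inequality makes \<open>A\<^sup>q - q / (q - 1) * A\<^bsup>q-1\<^esup> * b\<close> telescope.\<close>

lemma hardy_inequality_finite:
  fixes b :: "nat \<Rightarrow> real"
  assumes q: "1 < q" and b: "\<And>n. 0 < b n"
  defines "A \<equiv> \<lambda>n. (\<Sum>i<Suc n. b i) / real (Suc n)"
  shows "(\<Sum>n<N. A n powr q) \<le> 2 powr q / (q - 1) * (\<Sum>n<N. b n powr q)"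
proof -
  have A: "0 < A n" for n
    unfolding A_def using b by (intro divide_pos_pos sum_pos) auto
  have telescope: "(q - 1) * A n powr q - q * (A n powr (q - 1) * b n)
      \<le> (if n = 0 then 0 else real n * A (n - 1) powr q) - real (Suc n) * A n powr q" for n
  proof (cases n)
    case 0
    then have "A n = b n" by (simp add: A_def)
    moreover have "b n powr (q - 1) * b n = b n powr q"
      using b[of n] powr_add[of "b n" "q - 1" 1] by simp
    ultimately show ?thesis using 0 by (simp add: algebra_simps)
  next
    case (Suc k)
    have bn: "b n = real (Suc n) * A n - real n * A k"
    proof -
      have A_sum: "real (Suc m) * A m = (\<Sum>i<Suc m. b i)" for m
        by (simp add: A_def)
      show ?thesis using A_sum[of n] A_sum[of k] Suc by simp
    qed
    have AA: "A n powr (q - 1) * A n = A n powr q"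
      using A[of n] powr_add[of "A n" "q - 1" 1] by simp
    have "A n powr (q - 1) * b n
        = real (Suc n) * (A n powr (q - 1) * A n) - real n * (A n powr (q - 1) * A k)"
      by (simp add: bn algebra_simps)
    then have "q * (A n powr (q - 1) * b n)
        = q * (real (Suc n) * A n powr q) - real n * (q * (A n powr (q - 1) * A k))"
      by (simp only: AA) (simp add: algebra_simps)
    moreover have "real n * (q * (A n powr (q - 1) * A k))
        \<le> real n * ((q - 1) * A n powr q + A k powr q)"
      using Youngs_inequality_powr[OF q A A, of n k] by (intro mult_left_mono) auto
    ultimately show ?thesis using Suc by (simp add: algebra_simps)
  qed
  have "(\<Sum>n<N. (q - 1) * A n powr q - q * (A n powr (q - 1) * b n))
      \<le> - (if N = 0 then 0 else real N * A (N - 1) powr q)"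
  proof (induction N)
    case (Suc N)
    then show ?case using telescope[of N] by simp
  qed simp
  then have "(\<Sum>n<N. (q - 1) * A n powr q - q * (A n powr (q - 1) * b n)) \<le> 0"
    by (auto split: if_splits intro: order_trans)
  then have 1: "(q - 1) * (\<Sum>n<N. A n powr q) \<le> (\<Sum>n<N. q * (A n powr (q - 1) * b n))"
    by (simp add: sum_subtractf sum_distrib_left)
  \<comment> \<open>Young's inequality at \<open>2 * b n\<close>, halved: half of the left side of
    the previous estimate can be absorbed, which produces the constant
    \<open>2 powr q / (q - 1)\<close>.\<close>
  have "q * (A n powr (q - 1) * b n) \<le> (q - 1) / 2 * A n powr q + 2 powr q / 2 * b n powr q" for n
    using Youngs_inequality_powr[OF q A, of "2 * b n" n] b[of n] by (simp add: powr_mult field_simps)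
  then have "(\<Sum>n<N. q * (A n powr (q - 1) * b n))
      \<le> (\<Sum>n<N. (q - 1) / 2 * A n powr q + 2 powr q / 2 * b n powr q)"
    by (intro sum_mono)
  also have "\<dots> = (q - 1) / 2 * (\<Sum>n<N. A n powr q) + 2 powr q / 2 * (\<Sum>n<N. b n powr q)"
    by (simp add: sum.distrib sum_distrib_left)
  finally have "(q - 1) * (\<Sum>n<N. A n powr q) \<le> 2 powr q * (\<Sum>n<N. b n powr q)"
    using 1 by (simp add: field_simps)
  then show ?thesis using q by (simp add: field_simps)
qed

text \<open>Hardy's inequality with \<open>q = 1/\<mu> > 1\<close> for the sequence
  \<open>a n powr \<mu>\<close>: the \<open>q\<close>-th powers of its averages are the power means,
  and those of its terms are the \<open>a n\<close>.\<close>

lemma hardy_mean_power_mean_pos: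
  assumes "0 < \<mu>" "\<mu> < 1"
  shows "hardy_mean {0<..} (power_mean \<mu>)"
  unfolding hardy_mean_def
proof (intro exI ballI)
  let ?C = "2 powr (1/\<mu>) / (1/\<mu> - 1)"
  fix a :: "nat \<Rightarrow> real" assume "a \<in> l1_seqs {0<..}"
  then have a: "0 < a n" "summable a" for n by (auto simp: l1_seqs_def)
  let ?P = "\<lambda>n. power_mean \<mu> (map a [0..<Suc n])"
  have nonneg: "0 \<le> ?P n" for n using a by (intro power_mean_pos[THEN less_imp_le]) auto
  have P: "?P n = ((\<Sum>i<Suc n. a i powr \<mu>) / real (Suc n)) powr (1/\<mu>)" for n
    using assms by (simp add: power_mean_def interv_sum_list_conv_sum_set_nat o_def lessThan_atLeast0 del: upt_Suc)
  have bound: "(\<Sum>n<N. ?P n) \<le> ?C * (\<Sum>n. a n)" for N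
  proof -
    have "(\<Sum>n<N. ?P n) \<le> ?C * (\<Sum>n<N. (a n powr \<mu>) powr (1/\<mu>))"
    proof -
      have "0 < a n powr \<mu>" for n using a(1)[of n] by simp
      then show ?thesis
        unfolding P using assms by (intro hardy_inequality_finite) auto
    qed
    also have "(\<Sum>n<N. (a n powr \<mu>) powr (1/\<mu>)) = (\<Sum>n<N. a n)"
    proof (rule sum.cong)
      show "(a n powr \<mu>) powr (1/\<mu>) = a n" for n
        using assms a(1)[of n] by (simp add: powr_powr)
    qed simp
    also have "?C * (\<Sum>n<N. a n) \<le> ?C * (\<Sum>n. a n)"
      using assms a by (intro mult_left_mono sum_le_suminf) (auto simp: less_imp_le)
    finally show ?thesis .
  qed
  have sm: "summable ?P"
    using nonneg bound by (intro summableI_nonneg_bounded) auto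
  show "summable ?P \<and> (\<Sum>n. ?P n) \<le> ?C * (\<Sum>n. a n)"
    using sm bound by (auto intro: suminf_le_const)
qed

section \<open>Closure properties of Hardy means and exponents below one\<close>

lemma hardy_mean_mono:
  assumes "hardy_mean {0<..} M"
    and "\<And>v. \<lbrakk>v \<noteq> []; set v \<subseteq> {0<..}\<rbrakk> \<Longrightarrow> 0 \<le> M' v \<and> M' v \<le> M v"
  shows "hardy_mean {0<..} M'"
proof -
  obtain C where C: "\<forall>a\<in>l1_seqs {0<..}. summable (\<lambda>n. M (map a [0..<Suc n])) \<and>
      (\<Sum>n. M (map a [0..<Suc n])) \<le> C * (\<Sum>n. a n)"
    using assms(1) unfolding hardy_mean_def by (rule exE)
  have "summable (\<lambda>n. M' (map a [0..<Suc n])) \<and>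
      (\<Sum>n. M' (map a [0..<Suc n])) \<le> C * (\<Sum>n. a n)" if a: "a \<in> l1_seqs {0<..}" for a
  proof -
    have *: "0 \<le> M' (map a [0..<Suc n])" "M' (map a [0..<Suc n]) \<le> M (map a [0..<Suc n])" for n
      using a assms(2)[of "map a [0..<Suc n]"] by (auto simp: l1_seqs_def)
    have sm: "summable (\<lambda>n. M' (map a [0..<Suc n]))"
      by (rule summable_comparison_test'[OF conjunct1[OF bspec[OF C a]], of 0])
        (use * in \<open>simp del: upt_Suc\<close>)
    show ?thesis
      using sm suminf_le[OF *(2) sm] bspec[OF C a] by linarith
  qed
  then show ?thesis unfolding hardy_mean_def by (intro exI[of _ C] ballI)
qed

text \<open>The constants of the summands add up.\<close>

lemma hardy_mean_sum:
  assumes "finite S" "\<And>s. s \<in> S \<Longrightarrow> hardy_mean I (M s)"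
  shows "hardy_mean I (\<lambda>v. \<Sum>s\<in>S. M s v)"
proof -
  have "\<forall>s\<in>S. \<exists>C. \<forall>a\<in>l1_seqs I. summable (\<lambda>n. M s (map a [0..<Suc n])) \<and>
      (\<Sum>n. M s (map a [0..<Suc n])) \<le> C * (\<Sum>n. a n)"
    using assms(2) unfolding hardy_mean_def by (rule ballI)
  from bchoice[OF this] obtain C where
    *: "\<forall>s\<in>S. \<forall>a\<in>l1_seqs I. summable (\<lambda>n. M s (map a [0..<Suc n])) \<and>
      (\<Sum>n. M s (map a [0..<Suc n])) \<le> C s * (\<Sum>n. a n)"
    by (rule exE)
  have C: "summable (\<lambda>n. M s (map a [0..<Suc n]))"
    "(\<Sum>n. M s (map a [0..<Suc n])) \<le> C s * (\<Sum>n. a n)"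
    if "s \<in> S" "a \<in> l1_seqs I" for s a
    using bspec[OF bspec[OF * that(1)] that(2)] by (rule conjunct1, rule conjunct2)
  show ?thesis
    unfolding hardy_mean_def
  proof (intro exI[of _ "sum C S"] ballI conjI)
    fix a assume a: "a \<in> l1_seqs I"
    show "summable (\<lambda>n. \<Sum>s\<in>S. M s (map a [0..<Suc n]))"
      using C(1) a by (intro summable_sum)
    have "(\<Sum>n. \<Sum>s\<in>S. M s (map a [0..<Suc n])) = (\<Sum>s\<in>S. \<Sum>n. M s (map a [0..<Suc n]))"
      using C(1) a by (intro suminf_sum)
    also have "\<dots> \<le> (\<Sum>s\<in>S. C s * (\<Sum>n. a n))"
      using C(2) a by (intro sum_mono)
    also have "\<dots> = sum C S * (\<Sum>n. a n)"
      by (simp add: sum_distrib_right)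
    finally show "(\<Sum>n. \<Sum>s\<in>S. M s (map a [0..<Suc n])) \<le> sum C S * (\<Sum>n. a n)" .
  qed
qed

text \<open>Nonpositive exponents are dominated by the exponent 1/2, any value strictly between 0
  and 1 being suitable.\<close>

lemma hardy_mean_power_mean:
  assumes "\<alpha> < 1"
  shows "hardy_mean {0<..} (power_mean \<alpha>)"
proof (cases "0 < \<alpha>")
  case True
  then show ?thesis using assms by (rule hardy_mean_power_mean_pos)
next
  case False
  show ?thesis
  proof (rule hardy_mean_mono)
    show "hardy_mean {0<..} (power_mean (1/2))" by (rule hardy_mean_power_mean_pos) auto
    show "0 \<le> power_mean \<alpha> v \<and> power_mean \<alpha> v \<le> power_mean (1/2) v"
      if "v \<noteq> []" "set v \<subseteq> {0<..}" for v
      using that False power_mean_pos[OF that, of \<alpha>] by (auto intro: power_mean_le_pos_exponent)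
  qed
qed

lemma hardy_mean_gauss_product:
  assumes "lam \<noteq> []" "\<And>\<alpha>. \<alpha> \<in> set lam \<Longrightarrow> \<alpha> < 1"
  shows "hardy_mean {0<..} (gauss_product lam)"
proof (rule hardy_mean_mono)
  show "hardy_mean {0<..} (\<lambda>v. \<Sum>\<alpha>\<in>set lam. power_mean \<alpha> v)"
    using assms by (intro hardy_mean_sum hardy_mean_power_mean) auto
  show "0 \<le> gauss_product lam v \<and> gauss_product lam v \<le> (\<Sum>\<alpha>\<in>set lam. power_mean \<alpha> v)"
    if "v \<noteq> []" "set v \<subseteq> {0<..}" for v
    using gauss_product_pos[OF assms(1) that] gauss_product_le_sum_power_means[OF assms(1) that] by simp
qed

subsection \<open>Failure of the weak Hardy property\<close>

text \<open>Cauchy condensation cancels the linear factor and turns the logarithm into a multiple of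
  the index, leaving a p-series with exponent \<open>s\<close>.\<close>

lemma summable_bertrand_iff:
  fixes s :: real
  assumes "0 < s"
  shows "summable (\<lambda>n. 1 / (real (n + 2) * ln (real (n + 2)) powr s)) \<longleftrightarrow> 1 < s"
proof -
  \<comment> \<open>Since \<open>ln 1 = 0\<close>, the plain formula would give the junk value 0 at
    1 and break monotonicity; below 2 the value at 2 is repeated.\<close>
  define f where "f n = (let x = real (max 2 n) in 1 / (x * ln x powr s))" for n
  have "summable (\<lambda>n. 1 / (real (n + 2) * ln (real (n + 2)) powr s)) \<longleftrightarrow> summable (\<lambda>n. f (n + 2))"
  proof -
    have "f (n + 2) = 1 / (real (n + 2) * ln (real (n + 2)) powr s)" for n
      unfolding f_def Let_def by (subst max_absorb2) auto
    then show ?thesis by simp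
  qed
  also have "\<dots> \<longleftrightarrow> summable f" by (rule summable_iff_shift)
  also have "\<dots> \<longleftrightarrow> summable (\<lambda>n. 2 ^ n * f (2 ^ n))"
  proof (rule condensation_test)
    show "f (Suc m) \<le> f m" if "0 < m" for m
      unfolding f_def Let_def using assms
      by (intro divide_left_mono mult_mono powr_mono2 mult_pos_pos)  auto
    show "0 \<le> f n" for n by (simp add: f_def Let_def)
  qed
  \<comment> \<open>The condensed term at index 0 involves the artificial value \<open>f 1\<close>
    and is dropped.\<close>
  also have "\<dots> \<longleftrightarrow> summable (\<lambda>n. 2 ^ Suc n * f (2 ^ Suc n))"
    using summable_Suc_iff[of "\<lambda>n. 2 ^ n * f (2 ^ n)"] by simp
  also have "(\<lambda>n. 2 ^ Suc n * f (2 ^ Suc n)) = (\<lambda>n. ln 2 powr -s * real (Suc n) powr -s)"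
  proof
    fix n
    have "max 2 (2 ^ Suc n) = (2 ^ Suc n :: nat)"
      by (simp add: max_def)
    then have "2 ^ Suc n * f (2 ^ Suc n) = 1 / ln (2 ^ Suc n) powr s"
      by (simp add: f_def Let_def)
    also have "ln (2 ^ Suc n) = real (Suc n) * ln 2"
      by (rule ln_realpow)
    finally show "2 ^ Suc n * f (2 ^ Suc n) = ln 2 powr -s * real (Suc n) powr -s"
      by (simp add: powr_mult powr_minus_divide)
  qed
  also have "summable \<dots> \<longleftrightarrow> summable (\<lambda>n. real (Suc n) powr -s)"
    by (rule summable_cmult_iff[THEN trans]) auto
  also have "\<dots> \<longleftrightarrow> summable (\<lambda>n. real n powr -s)"
    by (rule summable_Suc_iff)
  also have "\<dots> \<longleftrightarrow> 1 < s" by (subst summable_real_powr_iff) auto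
  finally show ?thesis .
qed

lemma not_weak_hardy_mean_gauss_product:
  assumes "\<beta> \<in> set lam" "1 \<le> \<beta>"
  shows "\<not> weak_hardy_mean {0<..} (gauss_product lam)"
proof
  assume weak: "weak_hardy_mean {0<..} (gauss_product lam)"
  obtain \<theta> c where \<theta>: "0 < \<theta>" "\<theta> < 1" "0 < c" and lower:
    "\<And>v m y. \<lbrakk>set v \<subseteq> {m..}; y \<in> set v; 0 < m\<rbrakk> \<Longrightarrow>
      c * m * (y / real (length v) / m) powr \<theta> \<le> gauss_product lam v"
    using gauss_product_ge_powr[OF assms] by metis
  \<comment> \<open>The logarithm enters \<open>a n\<close> with power \<open>-s\<close> and the
    spread with power \<open>s * \<theta>\<close>. This \<open>s\<close> leaves total power -1, the
    divergent borderline of the Bertrand series.\<close>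
  define s where "s = 1 / (1 - \<theta>)"
  have s: "1 < s" "s - s * \<theta> = 1" using \<theta> by (auto simp: s_def field_simps)
  define a where "a n = 1 / (real (n + 2) * ln (real (n + 2)) powr s)" for n
  have a_pos: "0 < a n" for n by (simp add: a_def)
  have a_mono: "a n \<le> a i" if "i \<le> n" for i n
    unfolding a_def using that s
    by (intro divide_left_mono mult_mono powr_mono2 mult_pos_pos) auto
  have "summable a"
    using summable_bertrand_iff[of s] s by (simp add: a_def [abs_def])
  then have "a \<in> l1_seqs {0<..}"
    using a_pos by (simp add: l1_seqs_def)
  then have sm: "summable (\<lambda>n. gauss_product lam (map a [0..<Suc n]))"
    using weak by (auto simp: weak_hardy_mean_def)
  define d where "d = c * a 0 powr \<theta>"
  have d: "0 < d" using \<theta> a_pos[of 0] by (simp add: d_def)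
  have ge: "d * (1 / (real (n + 2) * ln (real (n + 2)) powr 1)) \<le> gauss_product lam (map a [0..<Suc n])" for n
  proof -
    define l where "l = ln (real (n + 2))"
    have l: "0 < l" by (simp add: l_def)
    have an: "a n = 1 / (real (n + 2) * l powr s)" by (simp only: a_def l_def)
    \<comment> \<open>The division by the length is offset by the linear factor in
      \<open>a n\<close>, so the spread still grows like \<open>l powr s\<close>.\<close>
    have "a 0 * l powr s \<le> a 0 / real (Suc n) / a n"
    proof -
      have "a 0 / real (Suc n) / a n = a 0 * l powr s * (real (n + 2) / real (Suc n))"
        unfolding an by simp
      moreover have "1 \<le> real (n + 2) / real (Suc n)" by simp
      ultimately show ?thesis
        using mult_left_mono[of 1 "real (n + 2) / real (Suc n)" "a 0 * l powr s"] a_pos[of 0] by simp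
    qed
    then have "(a 0 * l powr s) powr \<theta> \<le> (a 0 / real (Suc n) / a n) powr \<theta>"
      using \<theta> a_pos[of 0] by (intro powr_mono2) auto
    then have "c * a n * (a 0 * l powr s) powr \<theta> \<le> c * a n * (a 0 / real (Suc n) / a n) powr \<theta>"
      using \<theta> a_pos[of n] by (intro mult_left_mono) auto
    also have "\<dots> \<le> gauss_product lam (map a [0..<Suc n])"
    proof -
      have "c * a n * (a 0 / real (length (map a [0..<Suc n])) / a n) powr \<theta>
          \<le> gauss_product lam (map a [0..<Suc n])"
        \<comment> \<open>As \<open>a\<close> is decreasing, \<open>a n\<close> bounds the list from
          below, and \<open>a 0\<close> is the large entry.\<close>
        using a_mono a_pos by (intro lower) (auto simp del: upt_Suc)
      then show ?thesis by simp
    qed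
    finally have "c * a n * (a 0 * l powr s) powr \<theta> \<le> gauss_product lam (map a [0..<Suc n])" .
    moreover have "c * a n * (a 0 * l powr s) powr \<theta> = d * (1 / (real (n + 2) * l powr 1))"
    proof -
      have "s * \<theta> + 1 = s" using s(2) by simp
      then have "l powr s = l powr (s * \<theta>) * l powr 1"
        by (metis powr_add)
      moreover have "(a 0 * l powr s) powr \<theta> = a 0 powr \<theta> * l powr (s * \<theta>)"
        using l a_pos[of 0] by (simp add: powr_mult powr_powr)
      ultimately show ?thesis
        using l unfolding an d_def by simp
    qed
    ultimately show ?thesis by (simp add: l_def)
  qed
  have "summable (\<lambda>n. d * (1 / (real (n + 2) * ln (real (n + 2)) powr 1)))"
  proof (rule summable_comparison_test'[OF sm, of 0])
    fix n :: nat
    have "0 \<le> d * (1 / (real (n + 2) * ln (real (n + 2)) powr 1))" using d by simp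
    then show "norm (d * (1 / (real (n + 2) * ln (real (n + 2)) powr 1)))
        \<le> gauss_product lam (map a [0..<Suc n])"
      using ge[of n] by (simp only: real_norm_def abs_of_nonneg)
  qed
  then show False
    using summable_bertrand_iff[of 1] d by (subst (asm) summable_cmult_iff) auto
qed

text \<open>Both properties hold when all exponents are below 1, and both fail otherwise.\<close>

theorem mainTheorem3:
  fixes p :: nat and lam :: "real list"
  assumes "length lam = p + 1"
  shows "weak_hardy_mean {0<..} (gauss_product lam) \<longleftrightarrow> hardy_mean {0<..} (gauss_product lam)"
proof (cases "\<exists>\<beta>\<in>set lam. 1 \<le> \<beta>")
  case True
  then obtain \<beta> where "\<beta> \<in> set lam" "1 \<le> \<beta>" by (rule bexE)
  note not_weak = not_weak_hardy_mean_gauss_product[OF this]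
  then have "\<not> hardy_mean {0<..} (gauss_product lam)"
    by (rule contrapos_nn) (rule hardy_imp_weak_hardy_mean)
  with not_weak show ?thesis by (simp only:)
next
  case False
  have "lam \<noteq> []"
  proof
    assume "lam = []"
    with assms show False by simp
  qed
  then have hardy: "hardy_mean {0<..} (gauss_product lam)"
  proof (rule hardy_mean_gauss_product)
    show "\<alpha> < 1" if "\<alpha> \<in> set lam" for \<alpha>
      using False that by (simp add: not_le)
  qed
  with hardy_imp_weak_hardy_mean[OF hardy] show ?thesis by (simp only:)
qed

end
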